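(* Let $\varphi(z)=\frac{1}{\sqrt{2\pi}}e^{-z^2/2}$, $\Psi(z)=\int_z^\infty\varphi(w)\,dw$ for $z\in\mathbb{C}$, $R:=\varphi/\Psi$, and $H_+=\{z\in\mathbb{C}:\Re z\ge 0\}$. For all $z\in H_+\setminus\{0\}$, $$|R(z)|<\big|z+\sqrt{2/\pi}\big|,$$ whereas $R(0)=\sqrt{2/\pi}$. Moreover, $$\frac{R(z)}{z}\to 1\qquad\text{as } H_+\ni z\to\infty.$$
   Context: $\Psi$ is an entire function: the integral $\int_z^\infty\varphi(w)\,dw$ is taken along any path from $z$ to the point $\infty=\infty+0i$ of the extended real axis; equivalently $\Psi(z)=\frac12\operatorname{erfc}(z/\sqrt2)$. It has no zeros in $H_+$, so that $R$ (the inverse Mills ratio) is well defined on $H_+$. The limit "$H_+\ni z\to\infty$" means $|z|\to\infty$ with $z\in H_+$. *)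

theory Defs
  imports "HOL-Complex_Analysis.Complex_Analysis" "HOL-Probability.Probability"
    "HOL-Real_Asymp.Real_Asymp"
begin

definition phi :: "complex \<Rightarrow> complex" where
  "phi z = 1 / complex_of_real (sqrt (2 * pi)) * exp (- (z\<^sup>2) / 2)"

text \<open>
  A path from z to the point \<open>\<infinity> + 0i\<close> is parametrised by \<open>[0, \<infinity>)\<close>; each initial piece of it is
  a piecewise continuously differentiable path in the sense of the library.
\<close>

definition path_to_infinity :: "complex \<Rightarrow> (real \<Rightarrow> complex) \<Rightarrow> bool" where
  "path_to_infinity z \<gamma> \<longleftrightarrow>
     \<gamma> 0 = z \<and> (\<forall>T\<ge>0. valid_path (subpath 0 T \<gamma>)) \<and>
     filterlim (\<lambda>t. Re (\<gamma> t)) at_top at_top \<and> ((\<lambda>t. Im (\<gamma> t)) \<longlongrightarrow> 0) at_top"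

text \<open>
  The integral of \<^const>\<open>phi\<close> from z to \<open>\<infinity>\<close> along any path. That the common value exists and is
  unique is shown in \<open>Psi_along_path\<close>, \<open>Psi_eqI\<close> and \<open>path_to_infinity_exists\<close> below.
\<close>

definition Psi :: "complex \<Rightarrow> complex" where
  "Psi z = (THE I. \<forall>\<gamma>. path_to_infinity z \<gamma> \<longrightarrow>
              ((\<lambda>T. contour_integral (subpath 0 T \<gamma>) phi) \<longlongrightarrow> I) at_top)"

text \<open>
  The inverse Mills ratio. On the closed right half-plane the denominator does not vanish,
  see \<open>Psi_nonzero\<close> below.
\<close>

definition R :: "complex \<Rightarrow> complex" where
  "R z = phi z / Psi z"

definition H_plus :: "complex set" where
  "H_plus = {z. 0 \<le> Re z}"

lemma eventually_H_plus_at_infinity: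
  "(\<forall>\<^sub>F z in inf at_infinity (principal H_plus). P z) \<longleftrightarrow> (\<exists>b. \<forall>z\<in>H_plus. b \<le> norm z \<longrightarrow> P z)"
  by (auto simp: eventually_inf_principal eventually_at_infinity)


subsection \<open>Path independence\<close>

lemma phi_holomorphic: "phi holomorphic_on S"
  unfolding phi_def by (intro holomorphic_intros) auto

lemma isCont_phi: "isCont phi z"
  unfolding phi_def by (intro continuous_intros) auto

lemma norm_phi: "norm (phi z) = exp (((Im z)\<^sup>2 - (Re z)\<^sup>2) / 2) / sqrt (2 * pi)"
  by (simp add: phi_def norm_mult norm_divide Re_power2 field_simps)

lemma phi_primitive: obtains F where "\<And>z. (F has_field_derivative phi z) (at z)"
  using holomorphic_convex_primitive'[of UNIV phi, OF _ _ phi_holomorphic] by auto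

lemma path_to_infinity_exists: "\<exists>\<gamma>. path_to_infinity z \<gamma>"
proof
  define \<gamma> where "\<gamma> = (\<lambda>t. of_real (Re z + t) + \<i> * of_real (Im z * exp (- t)))"
  have "filterlim (\<lambda>t. Re z + t) at_top at_top"
    by (intro filterlim_tendsto_add_at_top[OF tendsto_const] filterlim_ident)
  moreover have "((\<lambda>t. Im z * exp (- t)) \<longlongrightarrow> 0) at_top"
    by real_asymp
  moreover have "valid_path (subpath 0 T \<gamma>)" for T
  proof -
    have "subpath 0 T \<gamma> C1_differentiable_on {0..1}"
      unfolding C1_differentiable_on_def subpath_def \<gamma>_def
      by (intro exI[of _ "\<lambda>t. of_real T - \<i> * of_real (T * Im z * exp (- (T * t)))"])
         (auto intro!: derivative_eq_intros continuous_intros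
            simp: has_vector_derivative_complex_iff)
    then show ?thesis
      unfolding valid_path_def by (rule C1_differentiable_imp_piecewise)
  qed
  ultimately show "path_to_infinity z \<gamma>"
    by (simp add: path_to_infinity_def \<gamma>_def complex_eq_iff)
qed

lemma contour_integral_phi_subpath:
  assumes F: "\<And>z. (F has_field_derivative phi z) (at z)"
    and "path_to_infinity z \<gamma>" "T \<ge> 0"
  shows "contour_integral (subpath 0 T \<gamma>) phi = F (\<gamma> T) - F z"
proof -
  have "(phi has_contour_integral
          F (pathfinish (subpath 0 T \<gamma>)) - F (pathstart (subpath 0 T \<gamma>))) (subpath 0 T \<gamma>)"
    using assms by (intro contour_integral_primitive[of UNIV])
      (auto simp: path_to_infinity_def intro: F)
  then show ?thesis
    using assms by (simp add: contour_integral_unique path_to_infinity_def)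
qed

lemma set_integrable_phi_horizontal: "set_integrable lborel {0..} (\<lambda>t. phi (z + complex_of_real t))"
proof -
  have "integrable lborel (\<lambda>t. phi (z + complex_of_real t))"
  proof (rule Bochner_Integration.integrable_bound)
    show "integrable lborel (\<lambda>t. exp ((Im z)\<^sup>2 / 2) * normal_density (- Re z) 1 t)"
      by simp
    show "(\<lambda>t. phi (z + complex_of_real t)) \<in> borel_measurable lborel"
      unfolding phi_def by measurable
    have "norm (phi (z + of_real t)) = exp ((Im z)\<^sup>2 / 2) * normal_density (- Re z) 1 t" for t
    proof -
      have "((Im z)\<^sup>2 - (Re z + t)\<^sup>2) / 2 = (Im z)\<^sup>2 / 2 + - (t - - Re z)\<^sup>2 / (2 * 1\<^sup>2)"
        by (simp add: diff_divide_distrib add.commute)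
      then show ?thesis
        by (simp add: norm_phi normal_density_def exp_add[symmetric])
    qed
    then show "AE t in lborel. norm (phi (z + of_real t))
                 \<le> norm (exp ((Im z)\<^sup>2 / 2) * normal_density (- Re z) 1 t)"
      by (simp add: normal_density_nonneg)
  qed
  then show ?thesis
    unfolding set_integrable_def by (rule integrable_mult_indicator[rotated]) auto
qed

lemma phi_primitive_tendsto_horizontal:
  assumes F: "\<And>z. (F has_field_derivative phi z) (at z)"
  shows "((\<lambda>T. F (z + of_real T)) \<longlongrightarrow> F z + (LBINT t:{0..}. phi (z + of_real t))) at_top"
proof -
  have "((\<lambda>T. LBINT t:{0..T}. phi (z + of_real t)) \<longlongrightarrow> (LBINT t:{0..}. phi (z + of_real t))) at_top"
    by (intro tendsto_set_lebesgue_integral_at_top set_integrable_phi_horizontal) auto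
  moreover have "(LBINT t:{0..T}. phi (z + of_real t)) = F (z + of_real T) - F z" if "T \<ge> 0" for T
  proof -
    have "set_integrable lborel {0..T} (\<lambda>t. phi (z + of_real t))"
      by (rule set_integrable_subset[OF set_integrable_phi_horizontal]) auto
    then have "(LBINT t:{0..T}. phi (z + of_real t)) = integral {0..T} (\<lambda>t. phi (z + of_real t))"
      by (rule set_borel_integral_eq_integral)
    also have "((\<lambda>t. phi (z + of_real t)) has_integral F (z + of_real T) - F (z + of_real 0)) {0..T}"
    proof (rule fundamental_theorem_of_calculus[OF that])
      fix t
      have "((F \<circ> (\<lambda>t. z + of_real t)) has_vector_derivative 1 * phi (z + of_real t)) (at t within {0..T})"
        by (rule field_vector_diff_chain_at[THEN has_vector_derivative_at_within])
           (auto intro!: derivative_eq_intros F)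
      then show "((\<lambda>t. F (z + of_real t)) has_vector_derivative phi (z + of_real t)) (at t within {0..T})"
        by (simp add: o_def)
    qed
    then have "integral {0..T} (\<lambda>t. phi (z + of_real t)) = F (z + of_real T) - F z"
      by (simp add: integral_unique)
    finally show ?thesis .
  qed
  then have "\<forall>\<^sub>F T in at_top. (LBINT t:{0..T}. phi (z + of_real t)) = F (z + of_real T) - F z"
    by (rule eventually_mono[OF eventually_ge_at_top[of 0]])
  ultimately have "((\<lambda>T. F (z + of_real T) - F z) \<longlongrightarrow> (LBINT t:{0..}. phi (z + of_real t))) at_top"
    by (rule Lim_transform_eventually)
  from tendsto_add[OF tendsto_const[of "F z"] this] show ?thesis by simp
qed

lemma phi_primitive_tendsto_strip:
  assumes F: "\<And>z. (F has_field_derivative phi z) (at z)"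
    and Re: "filterlim (\<lambda>t. Re (\<gamma> t)) at_top at_top"
    and Im: "\<forall>\<^sub>F t in at_top. \<bar>Im (\<gamma> t)\<bar> \<le> B"
  shows "((\<lambda>T. F (\<gamma> T)) \<longlongrightarrow> F 0 + (LBINT t:{0..}. phi (of_real t))) at_top"
proof -
  have 1: "((\<lambda>T. F (of_real (Re (\<gamma> T)))) \<longlongrightarrow> F 0 + (LBINT t:{0..}. phi (of_real t))) at_top"
    using filterlim_compose[OF phi_primitive_tendsto_horizontal[OF F, of 0] Re] by simp
  have 2: "((\<lambda>T. F (\<gamma> T) - F (of_real (Re (\<gamma> T)))) \<longlongrightarrow> 0) at_top"
  proof (rule Lim_null_comparison)
    show "\<forall>\<^sub>F T in at_top. norm (F (\<gamma> T) - F (of_real (Re (\<gamma> T))))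
            \<le> exp ((B\<^sup>2 - (Re (\<gamma> T))\<^sup>2) / 2) * B"
      using Im
    proof eventually_elim
      case (elim T)
      let ?S = "closed_segment (\<gamma> T) (of_real (Re (\<gamma> T)))"
      have "norm (phi w) \<le> exp ((B\<^sup>2 - (Re (\<gamma> T))\<^sup>2) / 2)" if w: "w \<in> ?S" for w
      proof -
        obtain u where u: "0 \<le> u" "u \<le> 1" "w = (1 - u) *\<^sub>R \<gamma> T + u *\<^sub>R of_real (Re (\<gamma> T))"
          using w by (auto simp: closed_segment_def)
        then have "\<bar>Im w\<bar> = (1 - u) * \<bar>Im (\<gamma> T)\<bar>" by (simp add: abs_mult)
        also have "\<dots> \<le> 1 * B" using u elim by (intro mult_mono) auto
        finally have "(Im w)\<^sup>2 \<le> B\<^sup>2" using power_mono[of "\<bar>Im w\<bar>" B 2] by simp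
        moreover have "Re w = Re (\<gamma> T)" by (simp only: u(3)) (simp add: left_diff_distrib)
        ultimately have "exp (((Im w)\<^sup>2 - (Re w)\<^sup>2) / 2) \<le> exp ((B\<^sup>2 - (Re (\<gamma> T))\<^sup>2) / 2)"
          by simp
        moreover have "1 \<le> sqrt (2 * pi)" using pi_gt3 by simp
        ultimately show ?thesis
          unfolding norm_phi
          using frac_le[of "exp ((B\<^sup>2 - (Re (\<gamma> T))\<^sup>2) / 2)" "exp (((Im w)\<^sup>2 - (Re w)\<^sup>2) / 2)" 1 "sqrt (2 * pi)"]
          by simp
      qed
      then have "norm (F (\<gamma> T) - F (of_real (Re (\<gamma> T))))
          \<le> exp ((B\<^sup>2 - (Re (\<gamma> T))\<^sup>2) / 2) * norm (\<gamma> T - of_real (Re (\<gamma> T)))"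
        by (intro field_differentiable_bound[of ?S F phi])
           (auto intro: F has_field_derivative_at_within)
      also have "norm (\<gamma> T - of_real (Re (\<gamma> T))) = \<bar>Im (\<gamma> T)\<bar>"
        by (simp add: cmod_def)
      also have "exp ((B\<^sup>2 - (Re (\<gamma> T))\<^sup>2) / 2) * \<bar>Im (\<gamma> T)\<bar> \<le> exp ((B\<^sup>2 - (Re (\<gamma> T))\<^sup>2) / 2) * B"
        using elim by (intro mult_left_mono) auto
      finally show ?case .
    qed
    have "((\<lambda>x. exp ((B\<^sup>2 - x\<^sup>2) / 2) * B) \<longlongrightarrow> 0) at_top"
      by real_asymp
    from filterlim_compose[OF this Re]
    show "((\<lambda>T. exp ((B\<^sup>2 - (Re (\<gamma> T))\<^sup>2) / 2) * B) \<longlongrightarrow> 0) at_top" .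
  qed
  from tendsto_add[OF 2 1] show ?thesis by simp
qed

lemma phi_primitive_tendsto_path:
  assumes F: "\<And>z. (F has_field_derivative phi z) (at z)"
    and \<gamma>: "path_to_infinity z \<gamma>"
  shows "((\<lambda>T. F (\<gamma> T)) \<longlongrightarrow> F 0 + (LBINT t:{0..}. phi (of_real t))) at_top"
proof (rule phi_primitive_tendsto_strip[OF F])
  show "filterlim (\<lambda>t. Re (\<gamma> t)) at_top at_top"
    using \<gamma> by (simp add: path_to_infinity_def)
  have "\<forall>\<^sub>F T in at_top. dist (Im (\<gamma> T)) 0 < 1"
    using \<gamma> by (intro tendstoD) (auto simp: path_to_infinity_def)
  then show "\<forall>\<^sub>F T in at_top. \<bar>Im (\<gamma> T)\<bar> \<le> 1"
    by eventually_elim simp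
qed

lemma contour_integral_phi_tendsto:
  assumes F: "\<And>z. (F has_field_derivative phi z) (at z)"
    and \<gamma>: "path_to_infinity z \<gamma>"
  shows "((\<lambda>T. contour_integral (subpath 0 T \<gamma>) phi)
            \<longlongrightarrow> F 0 + (LBINT t:{0..}. phi (of_real t)) - F z) at_top"
proof (rule Lim_transform_eventually)
  show "((\<lambda>T. F (\<gamma> T) - F z) \<longlongrightarrow> F 0 + (LBINT t:{0..}. phi (of_real t)) - F z) at_top"
    by (intro tendsto_diff phi_primitive_tendsto_path[OF F \<gamma>] tendsto_const)
  show "\<forall>\<^sub>F T in at_top. F (\<gamma> T) - F z = contour_integral (subpath 0 T \<gamma>) phi"
    using eventually_ge_at_top[of 0]
    by eventually_elim (simp add: contour_integral_phi_subpath[OF F \<gamma>])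
qed

lemma Psi_eqI:
  assumes "path_to_infinity z \<gamma>"
    and "((\<lambda>T. contour_integral (subpath 0 T \<gamma>) phi) \<longlongrightarrow> I) at_top"
  shows "Psi z = I"
proof -
  obtain F where F: "\<And>z. (F has_field_derivative phi z) (at z)" using phi_primitive by blast
  have "I = F 0 + (LBINT t:{0..}. phi (of_real t)) - F z"
    using tendsto_unique[OF _ assms(2) contour_integral_phi_tendsto[OF F assms(1)]] by simp
  then show ?thesis
    unfolding Psi_def
  proof (intro the_equality allI impI)
    fix \<gamma>' assume "path_to_infinity z \<gamma>'"
    then show "((\<lambda>T. contour_integral (subpath 0 T \<gamma>') phi) \<longlongrightarrow> I) at_top"
      using contour_integral_phi_tendsto[OF F] \<open>I = _\<close> by simp
  next
    fix J assume "\<forall>\<gamma>. path_to_infinity z \<gamma> \<longrightarrow>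
      ((\<lambda>T. contour_integral (subpath 0 T \<gamma>) phi) \<longlongrightarrow> J) at_top"
    then show "J = I" using assms tendsto_unique[OF trivial_limit_at_top_linorder] by blast
  qed
qed

lemma Psi_eq_primitive:
  assumes F: "\<And>z. (F has_field_derivative phi z) (at z)"
  shows "Psi z = F 0 + (LBINT t:{0..}. phi (of_real t)) - F z"
  using path_to_infinity_exists[of z] Psi_eqI contour_integral_phi_tendsto[OF F] by blast

lemma Psi_along_path:
  assumes "path_to_infinity z \<gamma>"
  shows "((\<lambda>T. contour_integral (subpath 0 T \<gamma>) phi) \<longlongrightarrow> Psi z) at_top"
proof -
  obtain F where F: "\<And>z. (F has_field_derivative phi z) (at z)" using phi_primitive by blast
  show ?thesis
    using contour_integral_phi_tendsto[OF F assms] by (simp add: Psi_eq_primitive[OF F])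
qed

lemma Psi_has_field_derivative: "(Psi has_field_derivative - phi z) (at z)"
proof -
  obtain F where F: "\<And>z. (F has_field_derivative phi z) (at z)" using phi_primitive by blast
  have "Psi = (\<lambda>z. F 0 + (LBINT t:{0..}. phi (of_real t)) - F z)"
    using Psi_eq_primitive[OF F] by blast
  then have "(Psi has_field_derivative - phi z) (at z) \<longleftrightarrow>
    ((\<lambda>z. F 0 + (LBINT t:{0..}. phi (of_real t)) - F z) has_field_derivative - phi z) (at z)"
    by (rule arg_cong)
  then show ?thesis by (auto intro!: derivative_eq_intros F)
qed

lemma Psi_eq_LBINT: "Psi z = (LBINT t:{0..}. phi (z + of_real t))"
proof -
  obtain F where F: "\<And>z. (F has_field_derivative phi z) (at z)" using phi_primitive by blast
  have "((\<lambda>T. F (z + of_real T)) \<longlongrightarrow> F 0 + (LBINT t:{0..}. phi (of_real t))) at_top"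
  proof (rule phi_primitive_tendsto_strip[OF F])
    show "filterlim (\<lambda>t. Re (z + of_real t)) at_top at_top"
      by (simp, intro filterlim_tendsto_add_at_top[OF tendsto_const] filterlim_ident)
    show "\<forall>\<^sub>F t in at_top. \<bar>Im (z + of_real t)\<bar> \<le> \<bar>Im z\<bar>" by simp
  qed
  from tendsto_unique[OF _ this phi_primitive_tendsto_horizontal[OF F]]
  show ?thesis by (simp add: Psi_eq_primitive[OF F])
qed


subsection \<open>Zeros\<close>

lemma Psi_0: "Psi 0 = 1 / 2"
proof -
  have "has_bochner_integral lborel (\<lambda>t. indicator {0..} t *\<^sub>R exp (- t\<^sup>2)) (sqrt pi / 2)"
    using gaussian_moment_0 by simp
  then have "has_bochner_integral lborel
      (\<lambda>t. indicator {0..} (0 + 1 / sqrt 2 * t) *\<^sub>R exp (- (0 + 1 / sqrt 2 * t)\<^sup>2))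
      ((sqrt pi / 2) /\<^sub>R \<bar>1 / sqrt 2\<bar>)"
    by (subst lborel_has_bochner_integral_real_affine_iff[of "1 / sqrt 2" _ _ 0, symmetric]) simp_all
  then have "has_bochner_integral lborel (\<lambda>t. indicator {0..} t *\<^sub>R exp (- t\<^sup>2 / 2)) (sqrt (2 * pi) / 2)"
    by (simp add: indicator_def zero_le_divide_iff power_divide real_sqrt_mult mult.commute)
  then have "has_bochner_integral lborel
      (\<lambda>t. 1 / sqrt (2 * pi) * (indicator {0..} t *\<^sub>R exp (- t\<^sup>2 / 2))) (1 / sqrt (2 * pi) * (sqrt (2 * pi) / 2))"
    by (rule has_bochner_integral_mult_right)
  then have "has_bochner_integral lborel
      (\<lambda>t. complex_of_real (1 / sqrt (2 * pi) * (indicator {0..} t *\<^sub>R exp (- t\<^sup>2 / 2)))) (of_real (1 / 2))"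
    by (intro has_bochner_integral_of_real) simp
  then have "(LBINT t. complex_of_real (1 / sqrt (2 * pi) * (indicator {0..} t *\<^sub>R exp (- t\<^sup>2 / 2)))) = of_real (1 / 2)"
    by (rule has_bochner_integral_integral_eq)
  also have "(\<lambda>t. complex_of_real (1 / sqrt (2 * pi) * (indicator {0..} t *\<^sub>R exp (- t\<^sup>2 / 2))))
      = (\<lambda>t. indicator {0..} t *\<^sub>R phi (of_real t))"
    by (rule ext) (simp add: phi_def scaleR_conv_of_real exp_of_real[symmetric])
  finally show ?thesis
    by (simp add: Psi_eq_LBINT set_lebesgue_integral_def)
qed

lemma Re_Psi_imaginary: "Re (Psi (\<i> * of_real y)) = 1 / 2"
proof -
  have "((\<lambda>y. Re (Psi (\<i> * of_real y))) has_real_derivative 0) (at y)" for y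
  proof -
    have "((Psi \<circ> (\<lambda>y. \<i> * of_real y)) has_vector_derivative \<i> * - phi (\<i> * of_real y)) (at y)"
      by (rule field_vector_diff_chain_at)
         (auto intro!: derivative_eq_intros Psi_has_field_derivative simp: has_vector_derivative_complex_iff)
    moreover have "phi (\<i> * of_real y) = of_real (1 / sqrt (2 * pi) * exp (y\<^sup>2 / 2))"
      by (simp add: phi_def power_mult_distrib exp_of_real[symmetric])
    ultimately show ?thesis
      by (simp add: has_vector_derivative_complex_iff o_def)
  qed
  then have "Re (Psi (\<i> * of_real y)) = Re (Psi (\<i> * of_real 0))"
    by (intro DERIV_isconst_all) auto
  then show ?thesis by (simp add: Psi_0)
qed

lemma set_integrable_exp_mscale: "0 < (u::real) \<Longrightarrow> set_integrable lborel {0..} (\<lambda>x. exp (- (x * u)))"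
  using lborel_integrable_real_affine_iff[of u "\<lambda>x. indicator {0 ..} x *\<^sub>R exp (- x)" 0]
        has_bochner_integral_I0i_power_exp_m'[of 0]
  by (simp add: indicator_def zero_le_mult_iff mult_ac integrable.intros set_integrable_def)

lemma set_integrable_cexp_mscale:
  assumes "0 < Re w" shows "set_integrable lborel {0..} (\<lambda>t. exp (- (w * of_real t)))"
  unfolding set_integrable_def
proof (rule Bochner_Integration.integrable_bound)
  show "integrable lborel (\<lambda>t. indicator {0..} t *\<^sub>R exp (- (t * Re w)))"
    using set_integrable_exp_mscale[OF assms] by (simp add: set_integrable_def)
qed (auto simp: mult.commute)

lemma LBINT_cexp_mscale:
  assumes "0 < Re w" shows "(LBINT t:{0..}. exp (- (w * of_real t))) = 1 / w"
proof -
  have w: "w \<noteq> 0" using assms by auto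
  have "((\<lambda>T. LBINT t:{0..T}. exp (- (w * of_real t))) \<longlongrightarrow> (LBINT t:{0..}. exp (- (w * of_real t)))) at_top"
    by (intro tendsto_set_lebesgue_integral_at_top set_integrable_cexp_mscale assms) auto
  moreover have "((\<lambda>T. LBINT t:{0..T}. exp (- (w * of_real t))) \<longlongrightarrow> 1 / w) at_top"
  proof (rule Lim_transform_eventually)
    have "(LBINT t:{0..T}. exp (- (w * of_real t))) = 1 / w - exp (- (w * of_real T)) / w" if "T \<ge> 0" for T
    proof -
      have "((\<lambda>t. exp (- (w * of_real t))) has_integral
              (- exp (- (w * of_real T)) / w - - exp (- (w * of_real 0)) / w)) {0..T}"
      proof (rule fundamental_theorem_of_calculus[OF that])
        fix t
        have "((\<lambda>s. - exp (- (w * s)) / w) has_field_derivative exp (- (w * of_real t))) (at (of_real t))"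
          using w by (auto intro!: derivative_eq_intros)
        then show "((\<lambda>t. - exp (- (w * of_real t)) / w) has_vector_derivative exp (- (w * of_real t)))
            (at t within {0..T})"
          by (rule has_vector_derivative_real_field[THEN has_vector_derivative_at_within])
      qed
      moreover have "set_integrable lborel {0..T} (\<lambda>t. exp (- (w * of_real t)))"
        by (rule set_integrable_subset[OF set_integrable_cexp_mscale[OF assms]]) auto
      ultimately show ?thesis
        by (simp add: set_borel_integral_eq_integral integral_unique)
    qed
    then show "\<forall>\<^sub>F T in at_top. 1 / w - exp (- (w * of_real T)) / w = (LBINT t:{0..T}. exp (- (w * of_real t)))"
      by (intro eventually_mono[OF eventually_ge_at_top[of 0]]) simp
    have "((\<lambda>T. exp (- (w * complex_of_real T))) \<longlongrightarrow> 0) at_top"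
    proof (rule tendsto_norm_zero_cancel)
      have "((\<lambda>T. exp (- (Re w * T))) \<longlongrightarrow> 0) at_top"
        using assms by real_asymp
      then show "((\<lambda>T. norm (exp (- (w * complex_of_real T)))) \<longlongrightarrow> 0) at_top" by simp
    qed
    from tendsto_diff[OF tendsto_const[of "1 / w"] tendsto_divide[OF this tendsto_const[of w] w]]
    show "((\<lambda>T. 1 / w - exp (- (w * complex_of_real T)) / w) \<longlongrightarrow> 1 / w) at_top" by simp
  qed
  ultimately show ?thesis
    using tendsto_unique[OF trivial_limit_at_top_linorder] by blast
qed

lemma Psi_eq_phi_times: "Psi z = phi z * (LBINT t:{0..}. exp (- (z * of_real t)) * of_real (exp (- (t\<^sup>2) / 2)))"
proof -
  have "phi (z + of_real t) = phi z * (exp (- (z * of_real t)) * of_real (exp (- (t\<^sup>2) / 2)))" for t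
  proof -
    have "- ((z + of_real t)\<^sup>2) / 2 = - (z\<^sup>2) / 2 + (- (z * of_real t) + of_real (- (t\<^sup>2) / 2))"
      by (simp add: power2_eq_square field_simps)
    then have "exp (- ((z + of_real t)\<^sup>2) / 2)
        = exp (- (z\<^sup>2) / 2) * (exp (- (z * of_real t)) * exp (of_real (- (t\<^sup>2) / 2)))"
      by (simp only: exp_add)
    then show ?thesis by (simp only: phi_def exp_of_real mult.assoc)
  qed
  then show ?thesis
    by (simp add: Psi_eq_LBINT)
qed

lemma LBINT_mills_eq:
  assumes "0 < Re z"
  shows "(LBINT t:{0..}. exp (- (z * of_real t)) * of_real (exp (- (t\<^sup>2) / 2)))
       = (CLINT x|std_normal_distribution. 1 / (z - \<i> * of_real x))"
    and "integrable std_normal_distribution (\<lambda>x. 1 / (z - \<i> * of_real x))"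
proof -
  interpret N: real_distribution std_normal_distribution by (rule real_dist_normal_dist)
  interpret P: pair_sigma_finite lborel std_normal_distribution ..
  define f where "f = (\<lambda>t x. indicator {0..} t *\<^sub>R exp (- ((z - \<i> * of_real x) * complex_of_real t)))"
  have [measurable]: "case_prod f \<in> borel_measurable (lborel \<Otimes>\<^sub>M std_normal_distribution)"
    unfolding f_def by measurable
  have norm_f: "norm (f t x) = indicator {0..} t *\<^sub>R exp (- (t * Re z))" for t x
    by (simp add: f_def mult.commute)
  have int: "integrable (lborel \<Otimes>\<^sub>M std_normal_distribution) (case_prod f)"
  proof (rule P.Fubini_integrable)
    show "integrable lborel (\<lambda>t. LINT x|std_normal_distribution. norm (case_prod f (t, x)))"
      using set_integrable_exp_mscale[OF assms] N.prob_space
      by (simp add: norm_f set_integrable_def)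
    show "AE t in lborel. integrable std_normal_distribution (\<lambda>x. case_prod f (t, x))"
    proof (rule AE_I2)
      fix t
      show "integrable std_normal_distribution (\<lambda>x. case_prod f (t, x))"
        by (rule N.integrable_const_bound[of _ "norm (f t 0)"]) (auto simp: norm_f f_def)
    qed
  qed auto
  have inner: "(LBINT t. f t x) = 1 / (z - \<i> * of_real x)" for x
    using LBINT_cexp_mscale[of "z - \<i> * of_real x"] assms by (simp add: f_def set_lebesgue_integral_def)
  have outer: "(CLINT x|std_normal_distribution. f t x)
      = indicator {0..} t *\<^sub>R (exp (- (z * of_real t)) * of_real (exp (- (t\<^sup>2) / 2)))" for t
  proof -
    have "f t x = (indicator {0..} t *\<^sub>R exp (- (z * of_real t))) * iexp (t * x)" for x
      by (simp add: f_def scaleR_conv_of_real exp_add[symmetric] algebra_simps)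
    then have "(CLINT x|std_normal_distribution. f t x)
        = (indicator {0..} t *\<^sub>R exp (- (z * of_real t))) * char std_normal_distribution t"
      unfolding char_def by simp
    then show ?thesis by (simp add: char_std_normal_distribution scaleR_conv_of_real)
  qed
  show "(LBINT t:{0..}. exp (- (z * of_real t)) * of_real (exp (- (t\<^sup>2) / 2)))
       = (CLINT x|std_normal_distribution. 1 / (z - \<i> * of_real x))"
    using P.Fubini_integral[OF int] by (simp add: inner outer set_lebesgue_integral_def)
  show "integrable std_normal_distribution (\<lambda>x. 1 / (z - \<i> * of_real x))"
    using P.integrable_snd[OF int] by (simp add: inner)
qed

lemma Psi_nonzero:
  assumes "z \<in> H_plus"
  shows "Psi z \<noteq> 0"
proof (cases "Re z = 0")
  case True
  then have "z = \<i> * of_real (Im z)" by (simp add: complex_eq_iff)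
  then show ?thesis using Re_Psi_imaginary[of "Im z"] by auto
next
  case False
  with assms have z: "0 < Re z" by (simp add: H_plus_def)
  interpret N: real_distribution std_normal_distribution by (rule real_dist_normal_dist)
  let ?g = "\<lambda>x. 1 / (z - \<i> * complex_of_real x)"
  have "0 < (LINT x|std_normal_distribution. Re (?g x))"
  proof -
    have "0 < Re (?g x)" for x
      using z by (simp add: Re_divide sum_power2_gt_zero_iff)
    then show ?thesis
      using LBINT_mills_eq(2)[OF z] by (intro N.expectation_greater) auto
  qed
  then have "0 < Re (CLINT x|std_normal_distribution. ?g x)"
    using LBINT_mills_eq(2)[OF z] by simp
  then have "(CLINT x|std_normal_distribution. ?g x) \<noteq> 0" by auto
  moreover have "phi z \<noteq> 0" by (simp add: phi_def)
  ultimately show ?thesis unfolding Psi_eq_phi_times[of z] LBINT_mills_eq(1)[OF z] by simp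
qed

end

theory Submission
  imports Defs
begin

text \<open>
  The quotient \<open>g z = R z / (z + sqrt (2 / pi))\<close> is holomorphic on the right half-plane and, since
  \<open>z\<^sup>2 \<Psi>(z) / \<phi>(z) - z\<close> is bounded there, tends to 1 at infinity. By the maximum principle it
  suffices to see that its modulus is below 1 on the imaginary axis away from 0. There
  \<open>Re (\<Psi>(\<i> y)) = 1 / 2\<close>, and \<open>J y = - Im (\<Psi>(\<i> y))\<close> satisfies \<open>J' y = c exp (y\<^sup>2 / 2)\<close>, so that the
  claim is a real inequality with equality at \<open>y = 0\<close>. Differentiating it twice, each time
  discarding a positive factor, leaves a positive quadratic polynomial in \<open>y\<^sup>2 + 2 / pi\<close>.
\<close>

lemma phi_nonzero: "phi z \<noteq> 0"
  by (simp add: phi_def)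

lemma phi_imaginary:
  "phi (\<i> * of_real y) = of_real (1 / sqrt (2 * pi) * exp (y\<^sup>2 / 2))"
  by (simp add: phi_def power_mult_distrib exp_of_real[symmetric])

lemma R_0: "R 0 = complex_of_real (sqrt (2 / pi))"
proof -
  \<comment> \<open>The right-hand side is \<open>phi 0 / Psi 0\<close>, since
    \<open>Psi 0 = 1 / 2\<close>.\<close>
  have "sqrt (2 / pi) = 2 / sqrt (2 * pi)"
    by (simp add: real_sqrt_mult real_sqrt_divide real_div_sqrt field_simps)
  then show ?thesis
    by (simp add: R_def phi_def Psi_0)
qed

subsection \<open>The imaginary axis\<close>

text \<open>A derivative with the sign of its argument makes 0 a strict global minimum. This turns
  the equality case at the origin into a strict inequality everywhere else on the imaginary
  axis.\<close>

lemma less_if_deriv_sgn: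
  fixes f f' :: "real \<Rightarrow> real"
  assumes f: "\<And>x. (f has_real_derivative f' x) (at x)"
    and pos: "\<And>x. x \<noteq> 0 \<Longrightarrow> 0 < x * f' x" and "y \<noteq> 0"
  shows "f 0 < f y"
proof (cases "y > 0")
  case True
  show ?thesis
  proof (rule DERIV_pos_imp_increasing_open[OF True])
    fix x :: real assume "0 < x"
    then show "\<exists>d. (f has_real_derivative d) (at x) \<and> 0 < d"
      using f[of x] pos[of x] by (auto simp: zero_less_mult_iff)
  qed (use f in \<open>auto intro!: continuous_at_imp_continuous_on DERIV_isCont\<close>)
next
  case False
  then have "y < 0" using \<open>y \<noteq> 0\<close> by simp
  then show ?thesis
  proof (rule DERIV_neg_imp_decreasing_open)
    fix x :: real assume "x < 0"
    then show "\<exists>d. (f has_real_derivative d) (at x) \<and> d < 0"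
      using f[of x] pos[of x] by (auto simp: zero_less_mult_iff)
  qed (use f in \<open>auto intro!: continuous_at_imp_continuous_on DERIV_isCont\<close>)
qed

text \<open>Since \<open>phi\<close> is real on the imaginary axis, the derivative
  \<open>- \<i> * phi (\<i> * y)\<close> is purely imaginary; only the imaginary part of
  \<open>Psi\<close> varies there.\<close>

lemma Im_Psi_imaginary_has_derivative:
  "((\<lambda>y. Im (Psi (\<i> * of_real y))) has_real_derivative - (1 / sqrt (2 * pi) * exp (y\<^sup>2 / 2))) (at y)"
proof -
  have "((Psi \<circ> (\<lambda>y. \<i> * of_real y)) has_vector_derivative \<i> * - phi (\<i> * of_real y)) (at y)"
    by (rule field_vector_diff_chain_at)
      (auto intro!: derivative_eq_intros Psi_has_field_derivative simp: has_vector_derivative_complex_iff)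
  then show ?thesis
    unfolding phi_imaginary by (simp add: has_vector_derivative_complex_iff o_def)
qed

text \<open>The quadratic in \<open>s\<close> has negative discriminant \<open>9 - 14 b - 7 b\<^sup>2\<close> for \<open>b = 2 / pi\<close>.\<close>

lemma quadratic_pos:
  fixes s :: real
  defines "b \<equiv> 2 / pi"
  shows "0 < (2 + b) * s\<^sup>2 - 3 * (1 + b) * s + 4 * b"
proof -
  \<comment> \<open>The positive root of \<open>7 * b * b + 14 * b - 9\<close> is near 0.51 and
    \<open>b\<close> is near 0.64, so 3/5 separates them comfortably.\<close>
  have b: "3 / 5 < b"
    using pi_approx by (simp add: b_def field_simps)
  have "0 < 14 * b + 7 * b * b - 9"
    using b mult_strict_mono[OF b b] by simp
  \<comment> \<open>Completing the square, after multiplying by four times the leading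
    coefficient.\<close>
  moreover have "4 * (2 + b) * ((2 + b) * s\<^sup>2 - 3 * (1 + b) * s + 4 * b)
      = (2 * (2 + b) * s - 3 * (1 + b))\<^sup>2 + (14 * b + 7 * b * b - 9)"
    by (simp add: power2_eq_square algebra_simps)
  ultimately have "0 < 4 * (2 + b) * ((2 + b) * s\<^sup>2 - 3 * (1 + b) * s + 4 * b)"
    by (simp add: add_nonneg_pos)
  then show ?thesis
    using b by (simp add: zero_less_mult_iff)
qed

text \<open>Squaring and dividing by \<open>y\<^sup>2 + b\<close> reduces the claim to
  \<open>F 0 < F y\<close>. The sign of \<open>F'\<close> is that of \<open>D\<close>, and
  \<open>D\<close> vanishes at 0 and increases because \<open>D'\<close> is a positive multiple of
  the polynomial in \<open>quadratic_pos\<close>.\<close>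

lemma norm_phi_less_imaginary:
  assumes "y \<noteq> 0"
  shows "norm (phi (\<i> * of_real y)) <
    norm (Psi (\<i> * of_real y)) * norm (\<i> * of_real y + complex_of_real (sqrt (2 / pi)))"
proof -
  define b where "b = 2 / pi"
  define c where "c = 1 / sqrt (2 * pi)"
  have b: "b > 0" by (simp add: b_def)
  have c: "c > 0" "c\<^sup>2 = 1 / (2 * pi)" by (simp_all add: c_def power_divide)
  define J where "J y = - Im (Psi (\<i> * of_real y))" for y
  have J: "(J has_real_derivative c * exp (y\<^sup>2 / 2)) (at y)" for y
    unfolding J_def c_def using DERIV_minus[OF Im_Psi_imaginary_has_derivative[of y]] by simp
  have J0: "J 0 = 0" by (simp add: J_def Psi_0)
  have s: "0 < y\<^sup>2 + b" for y using b by (simp add: add_nonneg_pos)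
  \<comment> \<open>Differentiating \<open>exp (y\<^sup>2) / (y\<^sup>2 + b)\<close> gives
    \<open>2 * exp (y\<^sup>2) * k y\<close>; hence \<open>2 * c * exp (y\<^sup>2 / 2)\<close>
    factors out of \<open>F'\<close> and leaves \<open>D\<close>.\<close>
  define k where "k y = y * (y\<^sup>2 + b - 1) / (y\<^sup>2 + b)\<^sup>2" for y
  \<comment> \<open>The quotient rule is left unsimplified, in the shape that
    \<open>DERIV_divide\<close> produces.\<close>
  define k' where "k' y = ((y\<^sup>2 + b - 1 + y * (2 * y)) * (y\<^sup>2 + b)\<^sup>2
      - y * (y\<^sup>2 + b - 1) * (2 * (y\<^sup>2 + b) * (2 * y))) / ((y\<^sup>2 + b)\<^sup>2 * (y\<^sup>2 + b)\<^sup>2)" for y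
  have k: "(k has_real_derivative k' y) (at y)" for y
    unfolding k_def k'_def using s[of y]
    by (intro DERIV_divide) (auto intro!: derivative_eq_intros)
  define D where "D y = J y - c * exp (y\<^sup>2 / 2) * k y" for y
  define D' where "D' y = c * exp (y\<^sup>2 / 2) *
    (((2 + b) * (y\<^sup>2 + b)\<^sup>2 - 3 * (1 + b) * (y\<^sup>2 + b) + 4 * b) / (y\<^sup>2 + b) ^ 3)" for y
  have D: "(D has_real_derivative D' y) (at y)" for y
  proof -
    have "(D has_real_derivative c * exp (y\<^sup>2 / 2) * (1 - y * k y - k' y)) (at y)"
      unfolding D_def by (auto intro!: derivative_eq_intros J k simp: algebra_simps)
    also have "c * exp (y\<^sup>2 / 2) * (1 - y * k y - k' y) = D' y"
    proof -
      \<comment> \<open>Both \<open>y * k y\<close> and \<open>k' y\<close> are even in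
        \<open>y\<close>, so replacing \<open>y * y\<close> by \<open>s - b\<close> leaves a
        rational identity in \<open>s\<close> alone.\<close>
      define s where "s = y\<^sup>2 + b"
      have s0: "s \<noteq> 0" using s[of y] by (simp add: s_def)
      have yy: "y * y = s - b" by (simp add: s_def power2_eq_square)
      have "y * (y * (s - 1) / s\<^sup>2) = (s - b) * (s - 1) / s\<^sup>2"
        by (simp flip: yy)
      moreover have "(s - 1 + y * (2 * y)) * s\<^sup>2 - y * (s - 1) * (2 * s * (2 * y))
          = (s - 1 + 2 * (s - b)) * s\<^sup>2 - 4 * (s - b) * (s - 1) * s"
        by (simp flip: yy add: algebra_simps)
      moreover have "1 - (s - b) * (s - 1) / s\<^sup>2
          - ((s - 1 + 2 * (s - b)) * s\<^sup>2 - 4 * (s - b) * (s - 1) * s) / (s\<^sup>2 * s\<^sup>2)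
          = ((2 + b) * s\<^sup>2 - 3 * (1 + b) * s + 4 * b) / s ^ 3"
        using s0 by (simp add: divide_simps) algebra
      ultimately show ?thesis
        by (simp only: D'_def k_def k'_def flip: s_def)
    qed
    finally show ?thesis .
  qed
  have D'_pos: "0 < D' y" for y
    unfolding D'_def using c s[of y] quadratic_pos[of "y\<^sup>2 + b"] by (simp add: b_def)
  have D0: "D 0 = 0" by (simp add: D_def k_def J0)
  have D_sgn: "0 < y * D y" if "y \<noteq> 0" for y
  proof (cases "y > 0")
    case True
    then show ?thesis using DERIV_pos_imp_increasing[of 0 y D] D D'_pos D0 by fastforce
  next
    case False
    then have "y < 0" using that by simp
    then have "D y < D 0" using DERIV_pos_imp_increasing[of y 0 D] D D'_pos by blast
    then show ?thesis using \<open>y < 0\<close> D0 by (simp add: zero_less_mult_iff)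
  qed
  define F where "F y = (J y)\<^sup>2 - c\<^sup>2 * exp (y\<^sup>2) / (y\<^sup>2 + b)" for y
  have F: "(F has_real_derivative 2 * c * exp (y\<^sup>2 / 2) * D y) (at y)" for y
  proof -
    have "exp (y\<^sup>2) = exp (y\<^sup>2 / 2) * exp (y\<^sup>2 / 2)" by (simp flip: exp_add)
    then show ?thesis
      unfolding F_def D_def k_def using s[of y]
      by (auto intro!: derivative_eq_intros J simp: field_simps power2_eq_square)
  qed
  have "F 0 < F y"
  proof (rule less_if_deriv_sgn[OF F _ assms])
    fix x :: real assume "x \<noteq> 0"
    then have "0 < 2 * c * exp (x\<^sup>2 / 2) * (x * D x)"
      using D_sgn c by simp
    then show "0 < x * (2 * c * exp (x\<^sup>2 / 2) * D x)"
      by (simp add: mult_ac)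
  qed
  \<comment> \<open>The value is \<open>- c\<^sup>2 / b\<close>. Its modulus 1/4 is also the square
    of the constant real part of \<open>Psi\<close> on the axis, so \<open>F 0 < F y\<close>
    rearranges to the squared claim.\<close>
  moreover have "F 0 = - 1 / 4"
    using c by (simp add: F_def J0 b_def)
  ultimately have "c\<^sup>2 * exp (y\<^sup>2) / (y\<^sup>2 + b) < 1 / 4 + (J y)\<^sup>2"
    unfolding F_def[of y] by linarith
  then have "c\<^sup>2 * exp (y\<^sup>2) < (1 / 4 + (J y)\<^sup>2) * (y\<^sup>2 + b)"
    using s[of y] by (simp add: pos_divide_less_eq)
  moreover have "(norm (phi (\<i> * of_real y)))\<^sup>2 = c\<^sup>2 * exp (y\<^sup>2)"
    unfolding phi_imaginary norm_of_real power2_abs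
    by (simp add: c_def power_mult_distrib power_divide flip: exp_of_nat_mult)
  moreover have "(norm (Psi (\<i> * of_real y)))\<^sup>2 = 1 / 4 + (J y)\<^sup>2"
    unfolding cmod_power2 by (simp add: Re_Psi_imaginary J_def power_divide)
  moreover have "(norm (\<i> * of_real y + complex_of_real (sqrt (2 / pi))))\<^sup>2 = y\<^sup>2 + b"
    unfolding cmod_power2 by (simp add: b_def)
  ultimately have "(norm (phi (\<i> * of_real y)))\<^sup>2 <
      (norm (Psi (\<i> * of_real y)) * norm (\<i> * of_real y + complex_of_real (sqrt (2 / pi))))\<^sup>2"
    by (simp only: power_mult_distrib)
  then show ?thesis
    by (rule power_less_imp_less_base) simp
qed

subsection \<open>Asymptotics\<close>

text \<open>The quotient \<open>Psi z / phi z\<close> is the Laplace transform of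
  \<open>exp (- (t\<^sup>2) / 2)\<close> at \<open>z\<close>. Two integrations by parts leave a
  remainder with integrand \<open>(1 - t\<^sup>2) * E t\<close>, and \<open>exp (- (z * t))\<close>
  has modulus at most 1 for \<open>t \<ge> 0\<close>. The bound is therefore uniform up to and
  including the imaginary axis.\<close>

lemma norm_mills_bound:
  obtains K where "\<And>z. z \<in> H_plus \<Longrightarrow> norm (z\<^sup>2 * (Psi z / phi z) - z) \<le> K"
proof -
  \<comment> \<open>A majorant independent of \<open>z\<close>, dominating both \<open>E\<close> and
    \<open>(1 - t\<^sup>2) * E t\<close>.\<close>
  define w where "w = (\<lambda>t::real. (1 + t\<^sup>2) * exp (- (t\<^sup>2) / 2))"
  have "norm (z\<^sup>2 * (Psi z / phi z) - z) \<le> (LBINT t:{0..}. w t)" if "z \<in> H_plus" for z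
  proof -
    from that have z: "0 \<le> Re z" by (simp add: H_plus_def)
    define E where "E = (\<lambda>t. exp (- (z * of_real t)) * complex_of_real (exp (- (t\<^sup>2) / 2)))"
    have int_w: "set_integrable lborel {0..} w"
    proof -
      \<comment> \<open>Integrability of \<open>w\<close> is that of the zeroth and second moments
        of the standard normal density.\<close>
      have "integrable lborel (\<lambda>t. sqrt (2 * pi) *
          (std_normal_density t * t ^ 0 + std_normal_density t * t ^ 2))"
        by (intro integrable_mult_right Bochner_Integration.integrable_add integrable_std_normal_moment)
      also have "(\<lambda>t. sqrt (2 * pi) *
          (std_normal_density t * t ^ 0 + std_normal_density t * t ^ 2)) = w"
        unfolding std_normal_density_def w_def by (rule ext) (simp add: algebra_simps)
      finally show ?thesis
        unfolding set_integrable_def by (rule integrable_mult_indicator[rotated]) auto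
    qed
    have norm_E: "norm (E t) \<le> exp (- (t\<^sup>2) / 2)" if "t \<ge> 0" for t
      using that z by (simp add: E_def norm_mult)
    have meas: "set_borel_measurable lborel {0..} (\<lambda>t. (1 - (of_real t)\<^sup>2) * E t)"
      "set_borel_measurable lborel {0..} E"
      unfolding set_borel_measurable_def E_def by measurable
    have bound: "norm ((1 - (of_real t)\<^sup>2) * E t) \<le> w t" "norm (E t) \<le> w t" if "t \<ge> 0" for t
    proof -
      have "norm (1 - (complex_of_real t)\<^sup>2) \<le> 1 + t\<^sup>2"
        using norm_triangle_ineq4[of 1 "(complex_of_real t)\<^sup>2"] by (simp add: norm_power)
      then show "norm ((1 - (of_real t)\<^sup>2) * E t) \<le> w t"
        unfolding norm_mult w_def using norm_E[OF that] by (intro mult_mono) auto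
      have "1 * norm (E t) \<le> w t"
        unfolding w_def using norm_E[OF that] by (intro mult_mono) auto
      then show "norm (E t) \<le> w t" by simp
    qed
    have int: "set_integrable lborel {0..} (\<lambda>t. (1 - (of_real t)\<^sup>2) * E t)"
      and int_E: "set_integrable lborel {0..} E"
      by (rule set_integrable_bound[OF int_w]; use meas bound in \<open>force simp: w_def\<close>)+
    have int_sum: "set_integrable lborel {0..} (\<lambda>t. z\<^sup>2 * E t + (1 - (of_real t)\<^sup>2) * E t)"
      by (intro set_integral_add set_integrable_mult_right int int_E)
    have "(LBINT t:{0..}. z\<^sup>2 * E t + (1 - (of_real t)\<^sup>2) * E t) = z"
    proof -
      \<comment> \<open>Two integrations by parts at once: \<open>H\<close> is a primitive of the integrand.\<close>
    define H where "H = (\<lambda>t. (of_real t - z) * E t)"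
      have H: "(H has_vector_derivative z\<^sup>2 * E t + (1 - (of_real t)\<^sup>2) * E t) (at t)" for t
      proof -
        have E_eq: "E = (\<lambda>t. exp (- (z * of_real t) - (of_real t)\<^sup>2 / 2))"
          unfolding E_def by (simp flip: exp_of_real exp_add)
        have "((\<lambda>t. (t - z) * exp (- (z * t) - t\<^sup>2 / 2)) has_field_derivative
            z\<^sup>2 * E t + (1 - (of_real t)\<^sup>2) * E t) (at (of_real t))"
          unfolding E_eq by (auto intro!: derivative_eq_intros simp: power2_eq_square algebra_simps)
        then show ?thesis
          unfolding H_def E_eq by (rule has_vector_derivative_real_field)
      qed
      have lim: "(H \<longlongrightarrow> 0) at_top"
      proof (rule Lim_null_comparison)
        show "\<forall>\<^sub>F t in at_top. norm (H t) \<le> (t + norm z) * exp (- (t\<^sup>2) / 2)"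
          using eventually_ge_at_top[of 0]
        proof eventually_elim
          case (elim t)
          then show ?case
            unfolding H_def norm_mult using norm_E[OF elim] norm_triangle_ineq4[of "of_real t" z]
            by (intro mult_mono) auto
        qed
        show "((\<lambda>t. (t + norm z) * exp (- (t\<^sup>2) / 2)) \<longlongrightarrow> 0) at_top"
          by real_asymp
      qed
      have "(LBINT t=0..\<infinity>. z\<^sup>2 * E t + (1 - (of_real t)\<^sup>2) * E t) = 0 - H 0"
      proof (rule interval_integral_FTC_integrable[where F = H])
        show "set_integrable lborel (einterval 0 \<infinity>) (\<lambda>t. z\<^sup>2 * E t + (1 - (of_real t)\<^sup>2) * E t)"
          by (rule set_integrable_subset[OF int_sum]) (auto simp: einterval_def)
        show "isCont (\<lambda>t. z\<^sup>2 * E t + (1 - (of_real t)\<^sup>2) * E t) t" for t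
          unfolding E_def by (intro continuous_intros) auto
        have "isCont H 0"
          unfolding H_def E_def by (intro continuous_intros) auto
        then have "(H \<longlongrightarrow> H 0) (at_right 0)"
          by (simp add: isCont_def filterlim_at_split)
        then show "((H \<circ> real_of_ereal) \<longlongrightarrow> H 0) (at_right 0)"
          by (simp add: zero_ereal_def ereal_tendsto_simps1)
        show "((H \<circ> real_of_ereal) \<longlongrightarrow> 0) (at_left \<infinity>)"
          using lim by (simp add: ereal_tendsto_simps1)
      qed (use H in auto)
      also have "0 - H 0 = z"
        by (simp add: H_def E_def)
      also have "(LBINT t=0..\<infinity>. z\<^sup>2 * E t + (1 - (of_real t)\<^sup>2) * E t)
          = (LBINT t:{0<..}. z\<^sup>2 * E t + (1 - (of_real t)\<^sup>2) * E t)"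
        by (simp add: interval_lebesgue_integral_0_infty)
      \<comment> \<open>The interval integral omits the endpoint 0, which is a null set.\<close>
      also have "\<dots> = (LBINT t:{0..}. z\<^sup>2 * E t + (1 - (of_real t)\<^sup>2) * E t)"
        unfolding set_lebesgue_integral_def
      proof (rule integral_cong_AE)
        show "AE t in lborel. indicator {0<..} t *\<^sub>R (z\<^sup>2 * E t + (1 - (of_real t)\<^sup>2) * E t)
            = indicator {0..} t *\<^sub>R (z\<^sup>2 * E t + (1 - (of_real t)\<^sup>2) * E t)"
          using AE_lborel_singleton[of 0] by eventually_elim (auto simp: indicator_def)
      qed (unfold E_def, measurable)
      finally show ?thesis by simp
    qed
    moreover have "(LBINT t:{0..}. z\<^sup>2 * E t + (1 - (of_real t)\<^sup>2) * E t)
        = z\<^sup>2 * (LBINT t:{0..}. E t) + (LBINT t:{0..}. (1 - (of_real t)\<^sup>2) * E t)"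
      by (subst set_integral_add) (auto intro!: set_integrable_mult_right int int_E)
    moreover have "Psi z / phi z = (LBINT t:{0..}. E t)"
      using phi_nonzero by (simp add: Psi_eq_phi_times E_def)
    ultimately have "z\<^sup>2 * (Psi z / phi z) - z = - (LBINT t:{0..}. (1 - (of_real t)\<^sup>2) * E t)"
      by (simp add: algebra_simps)
    then have "norm (z\<^sup>2 * (Psi z / phi z) - z) \<le> (LBINT t:{0..}. norm ((1 - (of_real t)\<^sup>2) * E t))"
      using set_integral_norm_bound[OF int] by (simp only: norm_minus_cancel)
    also have "\<dots> \<le> (LBINT t:{0..}. w t)"
      using bound by (intro set_integral_mono int_w set_integrable_norm int) auto
    finally show ?thesis .
  qed
  then show thesis by (rule that)
qed

text \<open>Dividing the preceding bound by \<open>norm z\<close> twice shows that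
  \<open>z * (Psi z / phi z)\<close> differs from 1 by O(1/|z|); \<open>R z / z\<close> is its
  inverse.\<close>

lemma R_over_id_tendsto: "((\<lambda>z. R z / z) \<longlongrightarrow> 1) (inf at_infinity (principal H_plus))"
proof -
  obtain K where K: "\<And>z. z \<in> H_plus \<Longrightarrow> norm (z\<^sup>2 * (Psi z / phi z) - z) \<le> K"
    using norm_mills_bound by blast
  let ?F = "inf at_infinity (principal H_plus)"
  have "((\<lambda>z. z * (Psi z / phi z) - 1) \<longlongrightarrow> 0) ?F"
  proof (rule Lim_null_comparison)
    show "\<forall>\<^sub>F z in ?F. norm (z * (Psi z / phi z) - 1) \<le> norm (of_real K / z)"
      unfolding eventually_H_plus_at_infinity
    proof (intro exI[of _ 1] ballI impI)
      fix z assume z: "z \<in> H_plus" "1 \<le> norm z"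
      have z_pos: "0 < norm z" using z(2) by linarith
      have "norm z * norm (z * (Psi z / phi z) - 1) = norm (z\<^sup>2 * (Psi z / phi z) - z)"
        unfolding norm_mult[symmetric] by (simp add: algebra_simps power2_eq_square)
      also have "\<dots> \<le> \<bar>K\<bar>" using K[OF z(1)] by simp
      finally show "norm (z * (Psi z / phi z) - 1) \<le> norm (of_real K / z)"
        using z(2) mult_imp_le_div_pos[of "norm z" "norm (z * (Psi z / phi z) - 1)" "\<bar>K\<bar>"] z_pos
        by (simp add: norm_divide mult.commute)
    qed
    have "((\<lambda>z. complex_of_real K / z) \<longlongrightarrow> 0) at_infinity"
      by (rule tendsto_divide_0[OF tendsto_const]) (simp add: filterlim_ident)
    then have "((\<lambda>z. complex_of_real K / z) \<longlongrightarrow> 0) ?F"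
      by (rule tendsto_mono[OF inf_le1])
    then show "((\<lambda>z. norm (complex_of_real K / z)) \<longlongrightarrow> 0) ?F"
      by (rule tendsto_norm_zero)
  qed
  from tendsto_inverse[OF tendsto_add[OF this tendsto_const[of 1]]]
  show ?thesis by (simp add: R_def field_simps)
qed

subsection \<open>The maximum principle\<close>

definition mills_quotient :: "complex \<Rightarrow> complex" where
  "mills_quotient z = R z / (z + complex_of_real (sqrt (2 / pi)))"

lemma shift_nonzero: "z \<in> H_plus \<Longrightarrow> z + complex_of_real (sqrt (2 / pi)) \<noteq> 0"
proof
  assume "z \<in> H_plus" and *: "z + complex_of_real (sqrt (2 / pi)) = 0"
  have "0 < sqrt (2 / pi)" by simp
  moreover have "Re z + sqrt (2 / pi) = 0" using arg_cong[OF *, of Re] by simp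
  moreover have "0 \<le> Re z" using \<open>z \<in> H_plus\<close> by (simp add: H_plus_def)
  ultimately show False by linarith
qed

text \<open>Differentiability within the closed half-plane also supplies the continuity up to the
  boundary that both uses of the maximum principle need.\<close>

lemma mills_quotient_holomorphic: "mills_quotient holomorphic_on H_plus"
proof -
  have "Psi holomorphic_on H_plus"
    using Psi_has_field_derivative[THEN has_field_derivative_at_within]
    by (auto simp: holomorphic_on_def field_differentiable_def)
  then show ?thesis
    unfolding mills_quotient_def R_def
    by (intro holomorphic_intros phi_holomorphic) (auto simp: Psi_nonzero shift_nonzero)
qed

lemma norm_mills_quotient_imaginary:
  assumes "Re z = 0" "z \<noteq> 0"
  shows "norm (mills_quotient z) < 1"
proof -
  have z: "z = \<i> * of_real (Im z)" using assms by (simp add: complex_eq_iff)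
  have H: "z \<in> H_plus" using assms by (simp add: H_plus_def)
  have "Im z \<noteq> 0" using assms by (simp add: complex_eq_iff)
  from norm_phi_less_imaginary[OF this] show ?thesis
    using Psi_nonzero[OF H] shift_nonzero[OF H]
    by (simp add: mills_quotient_def R_def norm_divide divide_less_eq flip: z norm_mult)
qed

lemma norm_mills_quotient_0: "norm (mills_quotient 0) = 1"
  by (simp add: mills_quotient_def R_0)

lemma mills_quotient_tendsto: "(mills_quotient \<longlongrightarrow> 1) (inf at_infinity (principal H_plus))"
proof -
  let ?F = "inf at_infinity (principal H_plus)"
  have "((\<lambda>z. complex_of_real (sqrt (2 / pi)) / z) \<longlongrightarrow> 0) at_infinity"
    by (rule tendsto_divide_0[OF tendsto_const]) (simp add: filterlim_ident)
  then have "((\<lambda>z. 1 + complex_of_real (sqrt (2 / pi)) / z) \<longlongrightarrow> 1 + 0) ?F"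
    by (intro tendsto_add tendsto_const) (rule tendsto_mono[OF inf_le1])
  then have "((\<lambda>z. (R z / z) / (1 + complex_of_real (sqrt (2 / pi)) / z)) \<longlongrightarrow> 1 / (1 + 0)) ?F"
    by (intro tendsto_divide R_over_id_tendsto) auto
  then have lim: "((\<lambda>z. (R z / z) / (1 + complex_of_real (sqrt (2 / pi)) / z)) \<longlongrightarrow> 1) ?F"
    by simp
  show ?thesis
  proof (rule Lim_transform_eventually[OF lim])
    show "\<forall>\<^sub>F z in ?F. (R z / z) / (1 + complex_of_real (sqrt (2 / pi)) / z) = mills_quotient z"
      unfolding eventually_H_plus_at_infinity
    proof (intro exI[of _ 1] ballI impI)
      fix z assume "z \<in> H_plus" "1 \<le> norm z"
      then have "z \<noteq> 0" by auto
      then have "1 + complex_of_real (sqrt (2 / pi)) / z = (z + complex_of_real (sqrt (2 / pi))) / z"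
        by (simp add: add_divide_distrib)
      then show "(R z / z) / (1 + complex_of_real (sqrt (2 / pi)) / z) = mills_quotient z"
        using \<open>z \<noteq> 0\<close> by (simp add: mills_quotient_def)
    qed
  qed
qed

lemma H_plus_interior_closure:
  "interior H_plus = {z. 0 < Re z}" "closed H_plus"
  "closure {z. 0 < Re z} = H_plus"
  unfolding H_plus_def
  using interior_halfspace_ge[of "1::complex" 0] closed_halfspace_Re_ge[of 0]
    closure_halfspace_gt[of "1::complex" 0]
  by (simp_all add: inner_complex_def)

text \<open>The half-plane is unbounded, so the maximum principle is applied on a large half-disc:
  the flat side is controlled by the imaginary-axis estimate, the arc by the limit at infinity up to
  an error \<open>e\<close>, which is then arbitrary.\<close>

lemma norm_mills_quotient_le_1:
  assumes z: "z \<in> H_plus"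
  shows "norm (mills_quotient z) \<le> 1"
proof (rule field_le_epsilon)
  fix e :: real assume "e > 0"
  have "\<forall>\<^sub>F w in inf at_infinity (principal H_plus). dist (mills_quotient w) 1 < e"
    using mills_quotient_tendsto \<open>e > 0\<close> by (rule tendstoD)
  then obtain b where b: "\<And>w. w \<in> H_plus \<Longrightarrow> b \<le> norm w \<Longrightarrow> dist (mills_quotient w) 1 < e"
    unfolding eventually_H_plus_at_infinity by blast
  \<comment> \<open>Large enough both to contain \<open>z\<close> and to put the arc where the
    quotient is within \<open>e\<close> of 1.\<close>
  define r where "r = max b (norm z + 1)"
  let ?S = "H_plus \<inter> cball 0 r"
  have closed: "closed ?S" using H_plus_interior_closure by auto
  show "norm (mills_quotient z) \<le> 1 + e"
  proof (rule maximum_modulus_frontier[where f = mills_quotient and S = ?S and \<xi> = z])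
    show "mills_quotient holomorphic_on interior ?S"
      using mills_quotient_holomorphic by (rule holomorphic_on_subset) (use interior_subset in blast)
    show "continuous_on (closure ?S) mills_quotient"
      using mills_quotient_holomorphic closed
      by (auto intro: holomorphic_on_imp_continuous_on holomorphic_on_subset)
    show "bounded ?S" by (simp add: bounded_Int)
    show "z \<in> ?S" using z by (auto simp: r_def)
    fix w assume w: "w \<in> frontier ?S"
    have wS: "w \<in> H_plus" "norm w \<le> r"
      using w closed by (auto simp: frontier_def)
    have "Re w = 0 \<or> norm w = r"
      using w wS
      by (auto simp: frontier_def interior_Int H_plus_interior_closure) (simp add: H_plus_def)
    then show "norm (mills_quotient w) \<le> 1 + e"
    proof
      assume "Re w = 0"
      then show ?thesis
        using norm_mills_quotient_imaginary[of w] norm_mills_quotient_0 \<open>e > 0\<close>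
        by (cases "w = 0") auto
    next
      assume "norm w = r"
      then have "norm (mills_quotient w - 1) < e"
        using b[OF wS(1)] by (simp add: r_def dist_norm)
      then show ?thesis
        using norm_triangle_sub[of "mills_quotient w" 1] by simp
    qed
  qed
qed

text \<open>Off the axis, modulus 1 would be attained at an interior maximum, forcing the quotient
  to be constant on the open half-plane and, by continuity, on its closure.\<close>

lemma norm_mills_quotient_less_1:
  assumes "z \<in> H_plus" "z \<noteq> 0"
  shows "norm (mills_quotient z) < 1"
proof (cases "Re z = 0")
  case True
  then show ?thesis using assms norm_mills_quotient_imaginary by blast
next
  case False
  let ?H = "{z. 0 < Re z}"
  have z: "z \<in> ?H" using False assms by (simp add: H_plus_def)
  have sub: "?H \<subseteq> H_plus" by (auto simp: H_plus_def)
  show ?thesis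
  proof (rule ccontr)
    assume "\<not> ?thesis"
    then have max: "norm (mills_quotient w) \<le> norm (mills_quotient z)" if "w \<in> ?H" for w
      using that sub norm_mills_quotient_le_1[of w] by (simp add: subset_iff)
    have "mills_quotient constant_on ?H"
    proof (rule maximum_modulus_principle[where U = ?H])
      show "mills_quotient holomorphic_on ?H"
        by (rule holomorphic_on_subset[OF mills_quotient_holomorphic sub])
      show "connected ?H" by (simp add: convex_halfspace_Re_gt convex_connected)
    qed (use max z in \<open>auto simp: open_halfspace_Re_gt\<close>)
    then obtain c where "\<And>w. w \<in> ?H \<Longrightarrow> mills_quotient w = c"
      unfolding constant_on_def by blast
    then have c: "mills_quotient w = c" if "w \<in> H_plus" for w
      using continuous_constant_on_closure[of ?H mills_quotient c w] that
        holomorphic_on_imp_continuous_on[OF mills_quotient_holomorphic]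
      by (simp add: H_plus_interior_closure)
    \<comment> \<open>Constancy fails on the boundary: the modulus is 1 at 0 but below 1 at
      \<open>\<i>\<close>.\<close>
    have "mills_quotient 0 = mills_quotient \<i>"
      using c[of 0] c[of \<i>] by (simp add: H_plus_def)
    then show False
      using norm_mills_quotient_0 norm_mills_quotient_imaginary[of \<i>] by simp
  qed
qed

theorem corollary1p5:
  shows "(\<forall>z\<in>H_plus - {0}. norm (R z) < norm (z + complex_of_real (sqrt (2 / pi)))) \<and>
         R 0 = complex_of_real (sqrt (2 / pi)) \<and>
         ((\<lambda>z. R z / z) \<longlongrightarrow> 1) (inf at_infinity (principal H_plus))"
proof (intro conjI ballI)
  fix z assume "z \<in> H_plus - {0}"
  then show "norm (R z) < norm (z + complex_of_real (sqrt (2 / pi)))"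
    using norm_mills_quotient_less_1[of z] shift_nonzero[of z]
    by (simp add: mills_quotient_def norm_divide)
qed (rule R_0 R_over_id_tendsto)+

end
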